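(* Let $N\ge 1$, let $w_0,\dots,w_N\in\mathbb{C}$ be nonzero and pairwise distinct, and let $\tau_0,\dots,\tau_N\in\mathbb{C}$. Let $M$ be the set of indices $m\in\{0,\dots,N\}$ with $-\tau_m\notin\mathbb{N}$, assumed nonempty. Put $W=\max_{m\in M}|w_m|$ and $T=\max\{\operatorname{Re}\tau_m: m\in M,\ |w_m|=W\}$. Then, as $n\to\infty$, $$G_n^{(N)}(\tau_j,w_j)=\sum_{\substack{m\in M\\ |w_m|=W,\ \operatorname{Re}\tau_m=T}}\frac{A_m(w_j)\,w_m^n}{n^{1-\tau_m}\,\Gamma(\tau_m)}+o\big(W^n n^{T-1}\big)$$ (with $1/\Gamma(0)=0$).
   Context: $\mathbb{N}=\{1,2,\dots\}$. The numbers $G_n^{(N)}(\tau_j,w_j)$ are the Maclaurin coefficients in $$\prod_{j=0}^{N}(1-w_jz)^{-\tau_j}=\sum_{n=0}^\infty G_n^{(N)}(\tau_j,w_j)\,z^n\qquad(|z|\text{ small}),$$ each power being the branch equal to $1$ at $z=0$. For $0\le m\le N$, $$A_m(w_j)=\prod_{\substack{j=0\\ j\ne m}}^{N}\Big(1-\frac{w_j}{w_m}\Big)^{-\tau_j}$$ with principal powers. *)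

theory Defs
  imports "HOL-Complex_Analysis.Complex_Analysis" "HOL-Library.Landau_Symbols"
begin

(* The principal branch powr takes the value 1 at z = 0 and is holomorphic near 0,
   so it is the branch required here. *)
definition gen_fun :: "nat \<Rightarrow> (nat \<Rightarrow> complex) \<Rightarrow> (nat \<Rightarrow> complex) \<Rightarrow> complex \<Rightarrow> complex" where
  "gen_fun N \<tau> w z = (\<Prod>j=0..N. (1 - w j * z) powr (- \<tau> j))"

definition G_coeff :: "nat \<Rightarrow> (nat \<Rightarrow> complex) \<Rightarrow> (nat \<Rightarrow> complex) \<Rightarrow> nat \<Rightarrow> complex" where
  "G_coeff N \<tau> w n = fps_nth (fps_expansion (gen_fun N \<tau> w) 0) n"

definition A_coeff :: "nat \<Rightarrow> (nat \<Rightarrow> complex) \<Rightarrow> (nat \<Rightarrow> complex) \<Rightarrow> nat \<Rightarrow> complex" where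
  "A_coeff N \<tau> w m = (\<Prod>j\<in>{0..N} - {m}. (1 - w j / w m) powr (- \<tau> j))"

lemma gen_fun_has_fps_expansion:
  "gen_fun N \<tau> w has_fps_expansion Abs_fps (G_coeff N \<tau> w)"
proof -
  have "gen_fun N \<tau> w analytic_on {0}"
    unfolding gen_fun_def by (intro analytic_intros) auto
  hence "gen_fun N \<tau> w has_fps_expansion fps_expansion (gen_fun N \<tau> w) 0"
    by (rule analytic_at_imp_has_fps_expansion_0)
  also have "fps_expansion (gen_fun N \<tau> w) 0 = Abs_fps (G_coeff N \<tau> w)"
    by (simp add: fps_eq_iff G_coeff_def)
  finally show ?thesis .
qed

end

theory Submission
  imports Defs "HOL-Real_Asymp.Real_Asymp"
begin

text \<open>
  The asymptotics are governed by the algebraic singularities \<open>1 / w m\<close> of the generating function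
  that lie closest to the origin. Dividing all \<open>w j\<close> by \<open>W\<close> multiplies the \<open>n\<close>-th coefficient by
  \<open>W ^ n\<close> and moves these singularities to the unit circle, so it suffices to treat a product of
  factors \<open>(1 - w j * z) powr (- t j)\<close> in which every \<open>w j\<close> either has norm 1, or has norm less
  than 1, or belongs to a factor that is a polynomial. The whole argument is carried out on the
  coefficient sequences; no contour integrals are used.

  If only one factor, with index \<open>a\<close>, has slowly decreasing coefficients, the product of
  all the others is a series \<open>h\<close> with coefficients of size \<open>O(k powr (- B))\<close> for a large \<open>B\<close>. The
  coefficients of the product are then the convolution of those of \<open>h\<close> with
  \<open>a ^ n * (- t gchoose n) * (- 1) ^ n\<close>, which behaves like \<open>a ^ n * n powr (t - 1) / Gamma t\<close>,
  and dominated convergence for series (Tannery's theorem) yields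
  \<open>h (1 / a) * a ^ n * n powr (t - 1) / Gamma t\<close>; this is \<open>mult_pow_fps_asymp\<close>. The
  value \<open>h (1 / a)\<close> on the boundary of the disc of convergence is the product of the principal powers
  by radial continuity (\<open>eval_pow_fps_closed_disc\<close>).

  Several singularities on the circle are separated by the identity
  \<open>(b * (1 - a * z) - a * (1 - b * z)) / (b - a) = 1\<close>. Multiplying the product by it
  (\<open>prod_pow_fps_split\<close>) gives a combination of two products of the same shape, in each of which one
  exponent \<open>t j\<close> has been lowered by 1. Lowering an exponent makes the coefficients of that factor
  smaller, so after finitely many steps at most one slowly decreasing factor remains. The claimed
  main terms are compatible with the identity up to the error term, and so the asymptotic formula
  follows by induction (\<open>prod_pow_fps_asymp\<close>).
\<close>


section \<open>The series of a power of a linear factor\<close>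

definition pow_fps :: "complex \<Rightarrow> complex \<Rightarrow> complex fps" where
  "pow_fps w t = Abs_fps (\<lambda>n. (- t gchoose n) * (- w) ^ n)"

lemma pow_fps_sums:
  assumes "norm (w * z) < 1"
  shows "(\<lambda>n. fps_nth (pow_fps w t) n * z ^ n) sums (1 - w * z) powr (- t)"
proof -
  have "(\<lambda>n. (- t gchoose n) * (- (w * z)) ^ n) sums (1 + (- (w * z))) powr (- t)"
    by (rule gen_binomial_complex) (use assms in simp)
  thus ?thesis
    by (simp add: pow_fps_def mult.assoc flip: power_mult_distrib)
qed

lemma pow_fps_has_fps_expansion:
  "(\<lambda>z. (1 - w * z) powr (- t)) has_fps_expansion pow_fps w t"
proof (rule has_fps_expansionI)
  have "((\<lambda>z. norm (w * z)) \<longlongrightarrow> norm (w * 0)) (nhds 0)"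
    by (intro tendsto_intros filterlim_ident)
  hence "\<forall>\<^sub>F z in nhds 0. norm (w * z) < 1"
    by (rule order_tendstoD) auto
  thus "\<forall>\<^sub>F z in nhds 0. (\<lambda>n. fps_nth (pow_fps w t) n * z ^ n) sums (1 - w * z) powr (- t)"
    by eventually_elim (rule pow_fps_sums)
qed

text \<open>
  Passing from \<open>t\<close> to \<open>t - 1\<close> is Pascal's rule for generalised binomial coefficients. On this
  rests the separation of the singularities.
\<close>

lemma pow_fps_diff_one:
  "pow_fps w (t - 1) = (1 - fps_const w * fps_X) * pow_fps w t"
proof (rule fps_ext)
  fix n
  show "fps_nth (pow_fps w (t - 1)) n = fps_nth ((1 - fps_const w * fps_X) * pow_fps w t) n"
  proof (cases n)
    case 0
    thus ?thesis by (simp add: pow_fps_def)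
  next
    case (Suc k)
    have "1 - t gchoose Suc k = (- t gchoose k) + (- t gchoose Suc k)"
      using gbinomial_Suc_Suc[of "- t" k] by (simp add: algebra_simps)
    with Suc show ?thesis
      by (simp add: pow_fps_def algebra_simps)
  qed
qed

lemma pow_fps_scale: "fps_nth (pow_fps (c * w) t) n = c ^ n * fps_nth (pow_fps w t) n"
proof -
  have "- (c * w) = c * (- w)" by simp
  thus ?thesis unfolding pow_fps_def by (simp only: fps_nth_Abs_fps power_mult_distrib mult_ac)
qed

lemma prod_pow_fps_scale:
  assumes "finite J"
  shows "fps_nth (\<Prod>j\<in>J. pow_fps (c * w j) (t j)) n =
           c ^ n * fps_nth (\<Prod>j\<in>J. pow_fps (w j) (t j)) n"
  using assms
proof (induction J arbitrary: n)
  case (insert x J)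
  let ?f = "\<lambda>c. pow_fps (c * w x) (t x)" and ?P = "\<lambda>c. \<Prod>j\<in>J. pow_fps (c * w j) (t j)"
  have "fps_nth (?f c * ?P c) n = c ^ n * fps_nth (?f 1 * ?P 1) n"
    unfolding fps_mult_nth sum_distrib_left
  proof (rule sum.cong[OF refl])
    fix i assume "i \<in> {0..n}"
    hence "c ^ n = c ^ i * c ^ (n - i)" by (simp flip: power_add)
    thus "fps_nth (?f c) i * fps_nth (?P c) (n - i) =
            c ^ n * (fps_nth (?f 1) i * fps_nth (?P 1) (n - i))"
      by (simp add: insert.IH pow_fps_scale)
  qed
  thus ?case using insert.hyps by simp
qed simp

section \<open>Growth of binomial coefficients\<close>

lemma gbinomial_asymp_powr:
  "(\<lambda>n. (- t gchoose n) * (- 1) ^ n / of_nat n powr (t - 1)) \<longlonglongrightarrow> rGamma (t :: complex)"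
proof (rule Lim_transform_eventually)
  show "(\<lambda>n. (- t gchoose n) / ((- 1) ^ n / exp ((- t + 1) * of_real (ln (real n)))))
          \<longlonglongrightarrow> rGamma t"
    using gbinomial_asymptotic[of "- t"] by (simp add: rGamma_inverse_Gamma)
  show "\<forall>\<^sub>F n in sequentially. (- t gchoose n) / ((- 1) ^ n / exp ((- t + 1) * of_real (ln (real n))))
          = (- t gchoose n) * (- 1) ^ n / of_nat n powr (t - 1)"
    using eventually_gt_at_top[of 0]
  proof eventually_elim
    case (elim n)
    have "of_nat n powr (t - 1) = inverse (exp ((- t + 1) * of_real (ln (real n))))"
      using elim by (simp add: powr_def Ln_of_nat algebra_simps flip: exp_minus)
    moreover have "inverse ((- 1) ^ n) = (- 1 :: complex) ^ n"
      by (simp flip: power_inverse)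
    ultimately show ?case by (simp add: divide_inverse)
  qed
qed

lemma norm_nat_powr: "n > 0 \<Longrightarrow> norm (of_nat n powr z :: complex) = real n powr Re z"
  by (simp add: norm_powr_real_powr)

text \<open>
  The shift to \<open>Suc n\<close> gives a bound that is valid at \<open>n = 0\<close> too, where \<open>real n powr (Re t - 1)\<close>
  vanishes.
\<close>

lemma gbinomial_norm_bound:
  obtains C where "\<And>n. norm ((- t gchoose n) :: complex) \<le> C * real (Suc n) powr (Re t - 1)"
proof -
  let ?q = "\<lambda>n. norm ((- t gchoose n) * (- 1) ^ n / of_nat n powr (t - 1)) *
                  (real n powr (Re t - 1) / real (Suc n) powr (Re t - 1))"
  let ?r = "\<lambda>n. norm (- t gchoose n) / real (Suc n) powr (Re t - 1)"
  have "(\<lambda>n. real n powr (Re t - 1) / real (Suc n) powr (Re t - 1)) \<longlonglongrightarrow> 1"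
    by real_asymp
  hence "?q \<longlonglongrightarrow> norm (rGamma t) * 1"
    by (intro tendsto_intros gbinomial_asymp_powr)
  moreover have "\<forall>\<^sub>F n in sequentially. ?q n = ?r n"
    using eventually_gt_at_top[of 0]
    by eventually_elim (simp add: norm_mult norm_divide norm_power norm_nat_powr)
  ultimately have "?r \<longlonglongrightarrow> norm (rGamma t)"
    using Lim_transform_eventually[of ?q] by simp
  hence "Bseq ?r"
    by (intro convergent_imp_Bseq) (auto simp: convergent_def)
  then obtain C where "\<And>n. norm (?r n) \<le> C"
    by (auto simp: Bseq_def)
  hence "norm (- t gchoose n) \<le> C * real (Suc n) powr (Re t - 1)" for n
    by (simp add: divide_le_eq)
  thus ?thesis by (rule that)
qed

section \<open>Series with rapidly decreasing coefficients\<close>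

text \<open>
  A sufficiently large \<open>B\<close> expresses smoothness on the closed unit disc: for \<open>B > 1\<close> such series
  converge absolutely there, and the class is closed under multiplication.
\<close>

definition decays :: "real \<Rightarrow> complex fps \<Rightarrow> bool" where
  "decays B f \<longleftrightarrow> (\<exists>C. \<forall>n. norm (fps_nth f n) \<le> C * real (Suc n) powr (- B))"

lemma decaysI_tendsto_0:
  assumes "(\<lambda>n. norm (fps_nth f n) * real (Suc n) powr B) \<longlonglongrightarrow> 0"
  shows "decays B f"
proof -
  have "Bseq (\<lambda>n. norm (fps_nth f n) * real (Suc n) powr B)"
    using assms by (intro convergent_imp_Bseq) (auto simp: convergent_def)
  then obtain C where "\<And>n. norm (norm (fps_nth f n) * real (Suc n) powr B) \<le> C"
    by (auto simp: Bseq_def)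
  thus ?thesis
    unfolding decays_def by (intro exI[of _ C]) (simp add: powr_minus field_simps)
qed

lemma decays_1: "decays B 1"
  unfolding decays_def by (intro exI[of _ 1]) auto

text \<open>
  In a term of index \<open>i\<close> of the convolution, one of \<open>Suc i\<close> and \<open>Suc (n - i)\<close> is at least half
  of \<open>Suc n\<close>. This factor supplies the decay in \<open>n\<close> and the other one is summable because \<open>B > 1\<close>.
\<close>

lemma decays_mult:
  assumes "decays B f" "decays B g" "B > 1"
  shows "decays B (f * g)"
proof -
  obtain C where C: "\<And>n. norm (fps_nth f n) \<le> C * real (Suc n) powr (- B)"
    using assms by (auto simp: decays_def)
  obtain D where D: "\<And>n. norm (fps_nth g n) \<le> D * real (Suc n) powr (- B)"
    using assms by (auto simp: decays_def)
  have C0: "C \<ge> 0" using order_trans[OF norm_ge_zero C[of 0]] by simp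
  have D0: "D \<ge> 0" using order_trans[OF norm_ge_zero D[of 0]] by simp
  define x where "x = (\<lambda>n. real (Suc n) powr (- B))"
  have x0: "x n \<ge> 0" for n by (simp add: x_def)
  have "summable x"
    using assms(3) summable_real_powr_iff[of "- B"] unfolding x_def
    by (subst summable_Suc_iff) auto
  hence x_sum: "sum x {..n} \<le> suminf x" for n
    using sum_le_suminf[of x "{..n}"] x0 by auto
  have split: "x i * x (n - i) \<le> 2 powr B * x n * (x i + x (n - i))" if "i \<le> n" for i n
  proof -
    \<comment> \<open>The larger index \<open>q\<close> satisfies \<open>2 * Suc q \<ge> Suc n\<close>; this is where \<open>2 powr B\<close> arises.\<close>
    have aux: "x p * x q \<le> 2 powr B * x n * x p" if "q \<ge> p" "p + q = n" for p q
    proof -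
      have "x q = 2 powr B * (2 * real (Suc q)) powr (- B)"
        unfolding x_def by (subst powr_mult) (auto simp: powr_minus field_simps)
      also have "\<dots> \<le> 2 powr B * x n"
        unfolding x_def using that assms(3) by (intro mult_left_mono powr_mono2') auto
      finally have "x p * x q \<le> x p * (2 powr B * x n)" by (rule mult_left_mono) (rule x0)
      thus ?thesis by (simp add: mult_ac)
    qed
    have nn: "0 \<le> 2 powr B * x n * x p" for p using x0 by simp
    show ?thesis
    proof (cases "i \<le> n - i")
      case True
      thus ?thesis using aux[of i "n - i"] that nn[of "n - i"] by (simp add: algebra_simps)
    next
      case False
      thus ?thesis using aux[of "n - i" i] that nn[of i] by (simp add: algebra_simps)
    qed
  qed
  have "norm (fps_nth (f * g) n) \<le> (C * D * 2 powr B * (suminf x + suminf x)) * x n" for n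
  proof -
    have "norm (fps_nth (f * g) n) \<le> (\<Sum>i\<le>n. norm (fps_nth f i) * norm (fps_nth g (n - i)))"
      unfolding fps_mult_nth atLeast0AtMost
      by (rule order_trans[OF norm_sum]) (simp add: norm_mult)
    also have "\<dots> \<le> (\<Sum>i\<le>n. (C * x i) * (D * x (n - i)))"
      using C D C0 x0 unfolding x_def by (intro sum_mono mult_mono mult_nonneg_nonneg norm_ge_zero)
    also have "\<dots> = C * D * (\<Sum>i\<le>n. x i * x (n - i))"
      by (simp add: sum_distrib_left mult_ac)
    also have "\<dots> \<le> C * D * (\<Sum>i\<le>n. 2 powr B * x n * (x i + x (n - i)))"
      using C0 D0 split by (intro mult_left_mono sum_mono) auto
    also have "(\<Sum>i\<le>n. 2 powr B * x n * (x i + x (n - i))) =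
        2 powr B * x n * (sum x {..n} + (\<Sum>i\<le>n. x (n - i)))"
      unfolding sum.distrib[symmetric] by (rule sum_distrib_left[symmetric])
    also have "(\<Sum>i\<le>n. x (n - i)) = sum x {..n}"
      by (rule sum.reindex_bij_witness[of _ "\<lambda>i. n - i" "\<lambda>i. n - i"]) auto
    also have "C * D * (2 powr B * x n * (sum x {..n} + sum x {..n}))
        \<le> C * D * (2 powr B * x n * (suminf x + suminf x))"
      using C0 D0 x0 x_sum[of n] by (intro mult_left_mono add_mono mult_nonneg_nonneg powr_ge_zero)
    finally show ?thesis by (simp only: mult_ac)
  qed
  thus ?thesis unfolding decays_def x_def by blast
qed

lemma decays_prod:
  assumes "\<And>j. j \<in> J \<Longrightarrow> decays B (f j)" "B > 1"
  shows "decays B (\<Prod>j\<in>J. f j)"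
  using assms(1)
proof (induction J rule: infinite_finite_induct)
  case (insert j J)
  have "decays B (f j * (\<Prod>j\<in>J. f j))"
    by (intro decays_mult insert.IH insert.prems assms(2)) simp_all
  thus ?case using insert.hyps by simp
qed (simp_all add: decays_1)

lemma decays_summable:
  assumes "decays B f" "B > 1" "norm z \<le> 1"
  shows "summable (\<lambda>n. norm (fps_nth f n * z ^ n))"
proof -
  obtain C where C: "\<And>n. norm (fps_nth f n) \<le> C * real (Suc n) powr (- B)"
    using assms by (auto simp: decays_def)
  have "summable (\<lambda>n. real (Suc n) powr (- B))"
    using assms(2) summable_real_powr_iff[of "- B"] by (subst summable_Suc_iff) auto
  hence "summable (\<lambda>n. C * real (Suc n) powr (- B))" by (rule summable_mult)
  moreover have "norm (norm (fps_nth f n * z ^ n)) \<le> C * real (Suc n) powr (- B)" for n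
  proof -
    have "norm (fps_nth f n * z ^ n) \<le> norm (fps_nth f n) * 1"
      unfolding norm_mult norm_power using assms(3) by (intro mult_left_mono power_le_one) auto
    with C[of n] show ?thesis by simp
  qed
  ultimately show ?thesis
    by (rule summable_comparison_test'[where N = 0])
qed

text \<open>
  The radius of convergence may be exactly 1, and \<open>z\<close> may lie on the circle. There multiplicativity
  follows from the Cauchy product of absolutely convergent series.
\<close>

lemma eval_fps_mult_decays:
  assumes "decays B f" "decays B g" "B > 1" "norm z \<le> 1"
  shows "eval_fps (f * g) z = eval_fps f z * eval_fps g z"
proof -
  have "(\<lambda>n. \<Sum>i\<le>n. fps_nth f i * z ^ i * (fps_nth g (n - i) * z ^ (n - i))) sums
          (eval_fps f z * eval_fps g z)"
    unfolding eval_fps_def using assms by (intro Cauchy_product_sums decays_summable)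
  also have "(\<lambda>n. \<Sum>i\<le>n. fps_nth f i * z ^ i * (fps_nth g (n - i) * z ^ (n - i))) =
             (\<lambda>n. fps_nth (f * g) n * z ^ n)"
  proof (intro ext)
    fix n
    have "fps_nth f i * z ^ i * (fps_nth g (n - i) * z ^ (n - i)) =
            fps_nth f i * fps_nth g (n - i) * z ^ n" if "i \<le> n" for i
    proof -
      have "z ^ n = z ^ i * z ^ (n - i)" using that by (simp flip: power_add)
      thus ?thesis by (simp only: mult_ac)
    qed
    thus "(\<Sum>i\<le>n. fps_nth f i * z ^ i * (fps_nth g (n - i) * z ^ (n - i))) =
            fps_nth (f * g) n * z ^ n"
      unfolding fps_mult_nth sum_distrib_right atLeast0AtMost by (intro sum.cong) simp_all
  qed
  finally show ?thesis by (simp add: eval_fps_def sums_iff)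
qed

lemma eval_fps_prod_decays:
  assumes "\<And>j. j \<in> J \<Longrightarrow> decays B (f j)" "B > 1" "norm z \<le> 1"
  shows "eval_fps (\<Prod>j\<in>J. f j) z = (\<Prod>j\<in>J. eval_fps (f j) z)"
  using assms(1)
proof (induction J rule: infinite_finite_induct)
  case (insert j J)
  have "decays B (\<Prod>j\<in>J. f j)"
    by (rule decays_prod[OF _ assms(2)]) (rule insert.prems, simp)
  moreover have "decays B (f j)"
    by (rule insert.prems) simp
  ultimately have "eval_fps (f j * (\<Prod>j\<in>J. f j)) z = eval_fps (f j) z * eval_fps (\<Prod>j\<in>J. f j) z"
    using assms(2,3) eval_fps_mult_decays by blast
  also have "eval_fps (\<Prod>j\<in>J. f j) z = (\<Prod>j\<in>J. eval_fps (f j) z)"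
    by (rule insert.IH) (rule insert.prems, simp)
  finally show ?case using insert.hyps by simp
qed simp_all

lemma decays_pow_fps_closed_disc:
  assumes "norm w \<le> 1" "Re t \<le> 1 - B"
  shows "decays B (pow_fps w t)"
proof -
  obtain C where C: "\<And>n. norm (- t gchoose n) \<le> C * real (Suc n) powr (Re t - 1)"
    using gbinomial_norm_bound[of t] by blast
  have C0: "C \<ge> 0" using order_trans[OF norm_ge_zero C[of 0]] by simp
  have "norm (fps_nth (pow_fps w t) n) \<le> C * real (Suc n) powr (- B)" for n
  proof -
    have "norm (fps_nth (pow_fps w t) n) \<le> norm (- t gchoose n) * 1"
      unfolding pow_fps_def using assms(1)
      by (auto simp: norm_mult norm_power intro!: mult_left_le power_le_one)
    also have "\<dots> \<le> C * real (Suc n) powr (Re t - 1)" using C by simp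
    also have "\<dots> \<le> C * real (Suc n) powr (- B)"
      using assms C0 by (intro mult_left_mono powr_mono) auto
    finally show ?thesis .
  qed
  thus ?thesis unfolding decays_def by blast
qed

text \<open>
  Geometric decay beats any power, for every exponent \<open>t\<close>.
\<close>

lemma decays_pow_fps_inside:
  assumes "norm w < 1"
  shows "decays B (pow_fps w t)"
proof (cases "w = 0")
  case True
  show ?thesis
  proof (rule decaysI_tendsto_0, rule tendsto_eventually)
    show "\<forall>\<^sub>F n in sequentially. norm (fps_nth (pow_fps w t) n) * real (Suc n) powr B = 0"
      using eventually_gt_at_top[of 0] by eventually_elim (simp add: pow_fps_def True)
  qed
next
  case False
  define q where "q = norm w"
  have q: "0 < q" "q < 1" using assms False by (auto simp: q_def)
  obtain C where C: "\<And>n. norm (- t gchoose n) \<le> C * real (Suc n) powr (Re t - 1)"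
    using gbinomial_norm_bound[of t] by blast
  have lim: "(\<lambda>n. C * (real (Suc n) powr (Re t - 1) * q ^ n * real (Suc n) powr B)) \<longlonglongrightarrow> C * 0"
  proof (intro tendsto_intros)
    define a where "a = Re t - 1 + B"
    define c where "c = - ln q"
    have "c > 0" using q by (simp add: c_def)
    hence "(\<lambda>n. real (Suc n) powr a * exp (- c * real n)) \<longlonglongrightarrow> 0"
      by real_asymp
    also have "(\<lambda>n. real (Suc n) powr a * exp (- c * real n)) =
        (\<lambda>n. real (Suc n) powr (Re t - 1) * q ^ n * real (Suc n) powr B)"
    proof
      fix n
      have "exp (- c * real n) = q ^ n"
        using q by (simp add: c_def mult.commute exp_of_nat_mult)
      thus "real (Suc n) powr a * exp (- c * real n) =
              real (Suc n) powr (Re t - 1) * q ^ n * real (Suc n) powr B"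
        by (simp add: a_def powr_add)
    qed
    finally show "(\<lambda>n. real (Suc n) powr (Re t - 1) * q ^ n * real (Suc n) powr B) \<longlonglongrightarrow> 0" .
  qed
  show ?thesis
  proof (rule decaysI_tendsto_0, rule Lim_null_comparison)
    show "(\<lambda>n. C * (real (Suc n) powr (Re t - 1) * q ^ n * real (Suc n) powr B)) \<longlonglongrightarrow> 0"
      using lim by simp
    show "\<forall>\<^sub>F n in sequentially. norm (norm (fps_nth (pow_fps w t) n) * real (Suc n) powr B)
            \<le> C * (real (Suc n) powr (Re t - 1) * q ^ n * real (Suc n) powr B)"
    proof (intro always_eventually allI)
      fix n
      have "norm (- t gchoose n) * (q ^ n * real (Suc n) powr B)
          \<le> C * real (Suc n) powr (Re t - 1) * (q ^ n * real (Suc n) powr B)"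
        using C q by (intro mult_right_mono) auto
      thus "norm (norm (fps_nth (pow_fps w t) n) * real (Suc n) powr B)
            \<le> C * (real (Suc n) powr (Re t - 1) * q ^ n * real (Suc n) powr B)"
        by (simp add: pow_fps_def norm_mult norm_power q_def mult_ac)
    qed
  qed
qed

lemma decays_pow_fps_polynomial: "decays B (pow_fps w (- of_nat k))"
proof (rule decaysI_tendsto_0, rule tendsto_eventually)
  show "\<forall>\<^sub>F n in sequentially. norm (fps_nth (pow_fps w (- of_nat k)) n) * real (Suc n) powr B = 0"
    using eventually_gt_at_top[of k]
    by eventually_elim (simp add: pow_fps_def flip: binomial_gbinomial)
qed

text \<open>
  Factors with exponent a natural number are entire, so there is no restriction on the norms of \<open>w\<close>
  and \<open>z\<close>. Such factors may have their zero \<open>1 / w\<close> anywhere, even inside the unit disc.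
\<close>

lemma eval_pow_fps_polynomial:
  assumes "1 - w * z \<noteq> 0"
  shows "eval_fps (pow_fps w (- of_nat k)) z = (1 - w * z) powr of_nat k"
proof -
  have "pow_fps w (- of_nat k) = (1 - fps_const w * fps_X) ^ k"
  proof (induction k)
    case (Suc k)
    have "- of_nat (Suc k) = - of_nat k - (1 :: complex)" by simp
    thus ?case using pow_fps_diff_one[of w "- of_nat k"] Suc by (simp only: power_Suc)
  qed (simp add: pow_fps_def fps_eq_iff gbinomial_0_left)
  moreover have "(1 - fps_const w * fps_X :: complex fps) = fps_of_poly [:1, - w:]"
    by (simp add: fps_of_poly_pCons fps_of_poly_simps fps_eq_iff)
  ultimately have "pow_fps w (- of_nat k) = fps_of_poly ([:1, - w:] ^ k)"
    by (simp add: fps_of_poly_power)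
  hence "eval_fps (pow_fps w (- of_nat k)) z = (1 - w * z) ^ k"
    by (simp add: poly_power mult.commute)
  thus ?thesis using assms by (simp add: powr_nat')
qed

text \<open>
  The binomial series is known to sum to the power for \<open>norm (w * z) < 1\<close>. On the boundary both
  sides are limits along the radius to \<open>z\<close>: the series by Tannery's theorem, and the principal power
  because \<open>1 - w * z\<close> has nonnegative real part and is nonzero, hence avoids the branch cut.
\<close>

lemma eval_pow_fps_closed_disc:
  assumes "decays B (pow_fps w t)" "B > 1" "norm z \<le> 1" "norm w \<le> 1" "w * z \<noteq> 1"
  shows "eval_fps (pow_fps w t) z = (1 - w * z) powr (- t)"
proof -
  define r :: "nat \<Rightarrow> complex" where "r = (\<lambda>n. of_real (1 - inverse (real (Suc n))))"
  let ?f = "pow_fps w t"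
  have r1: "norm (r n) < 1" for n
    unfolding r_def by (subst norm_of_real) (auto simp: field_simps)
  have "r \<longlonglongrightarrow> of_real 1"
    unfolding r_def by (intro tendsto_of_real) real_asymp
  hence rlim: "r \<longlonglongrightarrow> 1" by simp
  have wz: "norm (w * z) \<le> 1"
    unfolding norm_mult using assms by (intro mult_le_one) auto
  have series: "(\<lambda>n. \<Sum>k. fps_nth ?f k * (r n * z) ^ k) \<longlonglongrightarrow> (\<Sum>k. fps_nth ?f k * z ^ k)"
  proof (rule tannerys_theorem[THEN conjunct2, THEN conjunct2])
    show "summable (\<lambda>k. norm (fps_nth ?f k * z ^ k))"
      by (rule decays_summable[OF assms(1-3)])
    show "(\<lambda>n. fps_nth ?f k * (r n * z) ^ k) \<longlonglongrightarrow> fps_nth ?f k * z ^ k" for k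
      using rlim by (auto intro!: tendsto_eq_intros)
    show "\<forall>\<^sub>F (k, n) in at_top \<times>\<^sub>F sequentially.
            norm (fps_nth ?f k * (r n * z) ^ k) \<le> norm (fps_nth ?f k * z ^ k)"
    proof (intro always_eventually allI, clarify)
      fix k n
      have "norm (r n) ^ k \<le> 1" using r1[of n] by (intro power_le_one) auto
      hence "norm (fps_nth ?f k * z ^ k) * norm (r n) ^ k \<le> norm (fps_nth ?f k * z ^ k) * 1"
        by (intro mult_left_mono) auto
      thus "norm (fps_nth ?f k * (r n * z) ^ k) \<le> norm (fps_nth ?f k * z ^ k)"
        by (simp add: norm_mult norm_power power_mult_distrib mult_ac)
    qed
  qed auto
  have "norm (w * (r n * z)) < 1" for n
  proof -
    have "norm (w * (r n * z)) = norm (r n) * norm (w * z)"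
      by (simp add: norm_mult)
    also have "\<dots> \<le> norm (r n) * 1" using wz by (intro mult_left_mono) auto
    finally show ?thesis using r1[of n] by simp
  qed
  hence "(\<Sum>k. fps_nth ?f k * (r n * z) ^ k) = (1 - w * (r n * z)) powr (- t)" for n
    using pow_fps_sums[of w "r n * z" t] by (simp add: sums_iff)
  moreover have "(\<lambda>n. (1 - w * (r n * z)) powr (- t)) \<longlonglongrightarrow> (1 - w * (1 * z)) powr (- t)"
  proof (rule tendsto_powr_complex)
    show "1 - w * (1 * z) \<notin> \<real>\<^sub>\<le>\<^sub>0"
    proof
      assume "1 - w * (1 * z) \<in> \<real>\<^sub>\<le>\<^sub>0"
      then obtain x where x: "1 - w * z = of_real x" "x \<le> 0"
        by (auto elim!: nonpos_Reals_cases)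
      hence "w * z = of_real (1 - x)" by (simp add: algebra_simps)
      with wz x(2) have "x = 0" by (simp del: of_real_diff)
      with x assms(5) show False by simp
    qed
  qed (intro tendsto_intros rlim)+
  ultimately show ?thesis
    using LIMSEQ_unique[OF series] by (simp add: eval_fps_def)
qed

section \<open>One singular factor\<close>

text \<open>
  Two quantities that differ by at most a factor \<open>y\<close> in either direction have powers of exponent \<open>s\<close>
  that differ by at most a factor \<open>y powr \<bar>s\<bar>\<close>. The form of the bound is the same for both signs of \<open>s\<close>.
\<close>

lemma powr_ratio_bound:
  fixes x y n s :: real
  assumes "x > 0" "n > 0" "y > 0" "x \<le> y * n" "n \<le> y * x"
  shows "x powr s / n powr s \<le> y powr \<bar>s\<bar>"
proof (cases "s \<ge> 0")
  case True
  have "x powr s \<le> (y * n) powr s"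
    using assms True by (intro powr_mono2) auto
  thus ?thesis using True assms by (simp add: powr_mult divide_simps)
next
  case False
  have "n powr (- s) \<le> (y * x) powr (- s)"
    using assms False by (intro powr_mono2) auto
  thus ?thesis using False assms by (simp add: powr_mult powr_minus divide_simps mult_ac)
qed

text \<open>
  The termwise limit that is needed for the dominated convergence in a convolution. For \<open>n < k\<close> the
  truncated subtraction gives a meaningless value, which does not affect the limit.
\<close>

lemma gbinomial_shift_asymp:
  fixes t :: complex
  shows "(\<lambda>n. (- t gchoose (n - k)) * (- 1) ^ (n - k) / of_nat n powr (t - 1)) \<longlonglongrightarrow> rGamma t"
proof (rule LIMSEQ_offset[where k = k])
  let ?q = "\<lambda>n. (- t gchoose n) * (- 1) ^ n / of_nat n powr (t - 1) *
                  exp ((t - 1) * of_real (ln (real n) - ln (real (n + k))))"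
  have "(\<lambda>n. ln (real n) - ln (real (n + k))) \<longlonglongrightarrow> 0"
    unfolding of_nat_add by real_asymp
  hence "?q \<longlonglongrightarrow> rGamma t * exp ((t - 1) * of_real 0)"
    by (intro tendsto_intros gbinomial_asymp_powr)
  moreover have "\<forall>\<^sub>F n in sequentially. ?q n =
      (- t gchoose (n + k - k)) * (- 1) ^ (n + k - k) / of_nat (n + k) powr (t - 1)"
    using eventually_gt_at_top[of 0]
  proof eventually_elim
    case (elim n)
    have "exp ((t - 1) * of_real (ln (real n) - ln (real (n + k)))) =
            of_nat n powr (t - 1) / of_nat (n + k) powr (t - 1)"
      using elim by (simp add: powr_def Ln_of_nat right_diff_distrib exp_diff del: of_nat_add)
    moreover have "of_nat n powr (t - 1) \<noteq> 0" using elim by simp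
    ultimately show ?case by (simp del: of_nat_add)
  qed
  ultimately show "(\<lambda>n. (- t gchoose (n + k - k)) * (- 1) ^ (n + k - k) / of_nat (n + k) powr (t - 1))
      \<longlonglongrightarrow> rGamma t"
    using Lim_transform_eventually[of ?q] by simp
qed

text \<open>
  Written with \<open>rGamma\<close>, the formula also covers the nonpositive integers \<open>t\<close>, for which the
  power is a polynomial and the approximation is 0.
\<close>

definition pow_coeff_asymp :: "complex \<Rightarrow> complex \<Rightarrow> nat \<Rightarrow> complex" where
  "pow_coeff_asymp w t n = w ^ n * of_nat n powr (t - 1) * rGamma t"

lemma norm_pow_coeff_asymp:
  "n > 0 \<Longrightarrow> norm w = 1 \<Longrightarrow>
     norm (pow_coeff_asymp w t n) = real n powr (Re t - 1) * norm (rGamma t)"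
  by (simp add: pow_coeff_asymp_def norm_mult norm_power norm_nat_powr)

lemma pow_coeff_asymp_smallo:
  assumes "norm w = 1" "Re t < T"
  shows "pow_coeff_asymp w t \<in> o(\<lambda>n. of_real (real n powr (T - 1)))"
proof (rule smalloI_tendsto)
  show "\<forall>\<^sub>F n in sequentially. complex_of_real (real n powr (T - 1)) \<noteq> 0"
    using eventually_gt_at_top[of 0] by eventually_elim simp
  have "(\<lambda>n. real n powr (Re t - 1) / real n powr (T - 1)) \<longlonglongrightarrow> 0"
    using assms(2) by real_asymp
  hence "(\<lambda>n. real n powr (Re t - 1) / real n powr (T - 1) * norm (rGamma t)) \<longlonglongrightarrow>
           0 * norm (rGamma t)"
    by (intro tendsto_intros)
  moreover have "\<forall>\<^sub>F n in sequentially. norm (pow_coeff_asymp w t n / of_real (real n powr (T - 1)))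
      \<le> real n powr (Re t - 1) / real n powr (T - 1) * norm (rGamma t)"
    using eventually_gt_at_top[of 0]
    by eventually_elim (simp add: norm_divide norm_pow_coeff_asymp assms(1))
  ultimately show "(\<lambda>n. pow_coeff_asymp w t n / of_real (real n powr (T - 1))) \<longlonglongrightarrow> 0"
    using Lim_null_comparison by force
qed

lemma decays_smallo:
  assumes "decays B f" "- B < T - 1"
  shows "fps_nth f \<in> o(\<lambda>n. of_real (real n powr (T - 1)))"
proof (rule smalloI_tendsto)
  obtain C where C: "\<And>n. norm (fps_nth f n) \<le> C * real (Suc n) powr (- B)"
    using assms(1) by (auto simp: decays_def)
  show "\<forall>\<^sub>F n in sequentially. complex_of_real (real n powr (T - 1)) \<noteq> 0"
    using eventually_gt_at_top[of 0] by eventually_elim simp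
  define b where "b = - B"
  have "b < T - 1" using assms(2) by (simp add: b_def)
  hence "(\<lambda>n. real (Suc n) powr b / real n powr (T - 1)) \<longlonglongrightarrow> 0"
    by real_asymp
  hence "(\<lambda>n. C * (real (Suc n) powr (- B) / real n powr (T - 1))) \<longlonglongrightarrow> C * 0"
    unfolding b_def by (intro tendsto_intros)
  moreover have "\<forall>\<^sub>F n in sequentially. norm (fps_nth f n / of_real (real n powr (T - 1)))
      \<le> C * (real (Suc n) powr (- B) / real n powr (T - 1))"
    using eventually_gt_at_top[of 0]
    by eventually_elim (use C in \<open>simp add: norm_divide divide_right_mono\<close>)
  ultimately show "(\<lambda>n. fps_nth f n / of_real (real n powr (T - 1))) \<longlonglongrightarrow> 0"
    using Lim_null_comparison by force
qed

text \<open>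
  After division by \<open>a ^ n * n powr (T - 1)\<close> the coefficient becomes the sum over \<open>k\<close> of
  \<open>h k * (1 / a) ^ k\<close> times \<open>(- t gchoose (n - k)) * (- 1) ^ (n - k) / n powr (T - 1)\<close>. The difference
  from the claimed main term tends to 0 for every fixed \<open>k\<close>. It is dominated by a constant times
  \<open>Suc k powr (\<bar>T - 1\<bar> - B)\<close>, which is at most \<open>Suc k powr (- 2)\<close> by the choice of \<open>B\<close>, and
  Tannery's theorem applies. Normalising by \<open>T\<close> rather than by \<open>Re t\<close> makes \<open>B\<close> independent of \<open>t\<close>;
  in the induction below \<open>t\<close> is lowered while \<open>T\<close> and \<open>B\<close> stay fixed.
\<close>

lemma mult_pow_fps_asymp:
  assumes "decays B h" "B \<ge> \<bar>T - 1\<bar> + 2" "norm a = 1" "Re t \<le> T"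
  shows "(\<lambda>n. fps_nth (h * pow_fps a t) n - eval_fps h (1 / a) * pow_coeff_asymp a t n)
           \<in> o(\<lambda>n. of_real (real n powr (T - 1)))"
proof (rule smalloI_tendsto)
  show "\<forall>\<^sub>F n in sequentially. complex_of_real (real n powr (T - 1)) \<noteq> 0"
    using eventually_gt_at_top[of 0] by eventually_elim simp
next
  define s where "s = T - 1"
  define g where "g = (\<lambda>n. (- t gchoose n) * (- 1) ^ n)"
  define c where "c = (\<lambda>k. fps_nth h k * (1 / a) ^ k)"
  define p :: "nat \<Rightarrow> complex" where "p = (\<lambda>n. of_real (real n powr s))"
  define v where "v = (\<lambda>k n. c k * (if k \<le> n then g (n - k) else 0) / p n)"
  define y where "y = (\<lambda>n. of_nat n powr (t - 1) * rGamma t / p n)"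
  have a0: "a \<noteq> 0" using assms(3) by auto
  have B1: "B > 1" using assms(2) by linarith
  obtain H where H: "\<And>n. norm (fps_nth h n) \<le> H * real (Suc n) powr (- B)"
    using assms(1) by (auto simp: decays_def)
  have H0: "H \<ge> 0" using order_trans[OF norm_ge_zero H[of 0]] by simp
  obtain C where C: "\<And>n. norm (- t gchoose n) \<le> C * real (Suc n) powr (Re t - 1)"
    using gbinomial_norm_bound[of t] by blast
  have C0: "C \<ge> 0" using order_trans[OF norm_ge_zero C[of 0]] by simp
  have norm_c: "norm (c k) = norm (fps_nth h k)" for k
    by (simp add: c_def norm_mult norm_power norm_divide assms(3))
  have norm_q: "norm (of_nat n powr (t - 1) / p n) \<le> 1" if "n > 0" for n
  proof -
    have "real n powr (Re t - 1) \<le> real n powr s"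
      using that assms(4) by (intro powr_mono) (auto simp: s_def)
    thus ?thesis using that by (simp add: p_def norm_divide norm_nat_powr)
  qed

  have lim: "(\<lambda>n. v k n - c k * y n) \<longlonglongrightarrow> 0" for k
  proof (rule Lim_null_comparison)
    let ?e = "\<lambda>n. norm (g (n - k) / of_nat n powr (t - 1) - rGamma t)"
    have "?e \<longlonglongrightarrow> 0"
      using gbinomial_shift_asymp[of t k] unfolding g_def
      by (simp add: tendsto_norm_zero_iff flip: LIM_zero_iff[of _ "rGamma t"])
    hence "(\<lambda>n. norm (c k) * ?e n) \<longlonglongrightarrow> norm (c k) * 0"
      by (intro tendsto_intros)
    thus "(\<lambda>n. norm (c k) * ?e n) \<longlonglongrightarrow> 0" by simp
    show "\<forall>\<^sub>F n in sequentially. norm (v k n - c k * y n) \<le> norm (c k) * ?e n"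
      using eventually_gt_at_top[of k]
    proof eventually_elim
      case (elim n)
      let ?z = "of_nat n powr (t - 1) :: complex"
      have "?z \<noteq> 0" using elim by simp
      hence "v k n - c k * y n = c k * (g (n - k) / ?z - rGamma t) * (?z / p n)"
        using elim by (simp add: v_def y_def divide_simps) (simp add: algebra_simps)
      hence "norm (v k n - c k * y n) = norm (c k) * ?e n * norm (?z / p n)"
        by (simp only: norm_mult)
      also have "\<dots> \<le> norm (c k) * ?e n * 1"
        using norm_q[of n] elim by (intro mult_left_mono) auto
      finally show ?case by simp
    qed
  qed

  define M where "M = (\<lambda>k. H * (C * 2 powr \<bar>s\<bar> + norm (rGamma t)) * real (Suc k) powr (- 2))"
  have bound: "norm (v k n - c k * y n) \<le> M k" if "n > 0" for k n
  proof -
    let ?k = "real (Suc k)"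
    have k1: "?k powr \<bar>s\<bar> \<ge> 1" by (rule ge_one_powr_ge_zero) auto
    have g: "norm ((if k \<le> n then g (n - k) else 0) / p n) \<le> C * (2 * ?k) powr \<bar>s\<bar>"
    proof (cases "k \<le> n")
      case True
      \<comment> \<open>The quantities \<open>n\<close> and \<open>Suc (n - k)\<close> agree up to a factor \<open>2 * Suc k\<close>.\<close>
      have kn: "real (n - k) = real n - real k" using True by simp
      have "real n \<le> (2 * ?k) * real (Suc (n - k))"
      proof -
        have "(2 * ?k) * real (Suc (n - k)) = 2 * real n + 2 + 2 * real k * real (n - k)"
          unfolding kn of_nat_Suc by (simp add: algebra_simps kn)
        thus ?thesis by simp
      qed
      moreover have "real (Suc (n - k)) \<le> (2 * ?k) * real n"
      proof -
        have "real (Suc (n - k)) \<le> 2 * real n" using that by linarith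
        also have "\<dots> \<le> (2 * ?k) * real n" by (intro mult_right_mono) auto
        finally show ?thesis .
      qed
      ultimately have ratio: "real (Suc (n - k)) powr s / real n powr s \<le> (2 * ?k) powr \<bar>s\<bar>"
        using that by (intro powr_ratio_bound) auto
      have "norm (g (n - k)) \<le> C * real (Suc (n - k)) powr (Re t - 1)"
        using C[of "n - k"] by (simp add: g_def norm_mult norm_power)
      also have "\<dots> \<le> C * real (Suc (n - k)) powr s"
        using C0 assms(4) by (intro mult_left_mono powr_mono) (auto simp: s_def)
      finally have "norm (g (n - k) / p n) \<le> C * (real (Suc (n - k)) powr s / real n powr s)"
        using that by (simp add: norm_divide p_def divide_right_mono)
      also have "\<dots> \<le> C * (2 * ?k) powr \<bar>s\<bar>"
        using ratio C0 by (rule mult_left_mono)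
      finally show ?thesis using True by simp
    qed (use C0 in simp)
    have "norm (y n) = norm (of_nat n powr (t - 1) / p n) * norm (rGamma t)"
      by (simp add: y_def norm_mult norm_divide)
    also have "\<dots> \<le> 1 * norm (rGamma t)"
      by (rule mult_right_mono[OF norm_q[OF that]]) simp
    also have "\<dots> \<le> norm (rGamma t) * ?k powr \<bar>s\<bar>"
      using mult_left_mono[OF k1, of "norm (rGamma t)"] by simp
    finally have y: "norm (y n) \<le> norm (rGamma t) * ?k powr \<bar>s\<bar>" .
    have "v k n - c k * y n = c k * ((if k \<le> n then g (n - k) else 0) / p n - y n)"
      by (simp add: v_def right_diff_distrib)
    hence "norm (v k n - c k * y n) =
        norm (fps_nth h k) * norm ((if k \<le> n then g (n - k) else 0) / p n - y n)"
      by (simp only: norm_mult norm_c)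
    also have "\<dots> \<le> (H * ?k powr (- B)) *
        (C * (2 * ?k) powr \<bar>s\<bar> + norm (rGamma t) * ?k powr \<bar>s\<bar>)"
      using g y H[of k] H0
      by (intro mult_mono order_trans[OF norm_triangle_ineq4] add_mono mult_nonneg_nonneg) auto
    also have "\<dots> = H * (C * 2 powr \<bar>s\<bar> + norm (rGamma t)) * ?k powr (- B + \<bar>s\<bar>)"
    proof -
      have "(2 * ?k) powr \<bar>s\<bar> = 2 powr \<bar>s\<bar> * ?k powr \<bar>s\<bar>"
        by (rule powr_mult; simp)
      thus ?thesis unfolding powr_add by (simp only: distrib_left distrib_right mult_ac)
    qed
    also have "\<dots> \<le> M k"
      unfolding M_def using H0 C0 assms(2) by (intro mult_left_mono powr_mono) (auto simp: s_def)
    finally show ?thesis .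
  qed

  have "(\<lambda>n. \<Sum>k. v k n - c k * y n) \<longlonglongrightarrow> (\<Sum>k. 0)"
  proof (rule tannerys_theorem[THEN conjunct2, THEN conjunct2])
    show "summable M"
      unfolding M_def using summable_real_powr_iff[of "- 2"]
      by (intro summable_mult, subst summable_Suc_iff) auto
    have "\<forall>\<^sub>F n in sequentially. \<forall>k. norm (v k n - c k * y n) \<le> M k"
      using eventually_gt_at_top[of 0] by eventually_elim (auto intro: bound)
    hence "\<forall>\<^sub>F x in at_top \<times>\<^sub>F sequentially. \<forall>k. norm (v k (snd x) - c k * y (snd x)) \<le> M k"
      using filterlim_snd unfolding filterlim_iff by blast
    thus "\<forall>\<^sub>F (k, n) in at_top \<times>\<^sub>F sequentially. norm (v k n - c k * y n) \<le> M k"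
      by eventually_elim auto
  qed (use lim in auto)
  hence series: "(\<lambda>n. a ^ n * (\<Sum>k. v k n - c k * y n)) \<longlonglongrightarrow> 0"
    by (intro tendsto_norm_zero_cancel[of "\<lambda>n. a ^ n * (\<Sum>k. v k n - c k * y n)"])
       (simp add: norm_mult norm_power assms(3) tendsto_norm_zero)
  have "a ^ n * (\<Sum>k. v k n - c k * y n) =
          (fps_nth (h * pow_fps a t) n - eval_fps h (1 / a) * pow_coeff_asymp a t n) / p n" for n
  proof -
    have "c sums eval_fps h (1 / a)"
      using decays_summable[OF assms(1) B1, of "1 / a"] assms(3)
      by (simp add: c_def eval_fps_def summable_norm_cancel summable_sums norm_divide)
    hence "(\<lambda>k. c k * y n) sums (eval_fps h (1 / a) * y n)" by (rule sums_mult2)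
    moreover have "(\<lambda>k. v k n) sums (\<Sum>k\<le>n. v k n)"
      by (intro sums_finite) (auto simp: v_def)
    ultimately have "(\<Sum>k. v k n - c k * y n) = (\<Sum>k\<le>n. v k n) - eval_fps h (1 / a) * y n"
      by (intro sums_unique[symmetric] sums_diff)
    moreover have "a ^ n * (\<Sum>k\<le>n. v k n) = fps_nth (h * pow_fps a t) n / p n"
      unfolding fps_mult_nth atLeast0AtMost sum_distrib_left sum_divide_distrib
    proof (rule sum.cong[OF refl])
      fix k assume "k \<in> {..n}"
      hence "a ^ n = a ^ k * a ^ (n - k)" by (simp flip: power_add)
      moreover have "(- a) ^ (n - k) = (- 1) ^ (n - k) * a ^ (n - k)"
        by (rule power_minus)
      moreover have "a ^ k \<noteq> 0" using a0 by simp
      ultimately show "a ^ n * v k n = fps_nth h k * fps_nth (pow_fps a t) (n - k) / p n"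
        using \<open>k \<in> {..n}\<close> by (simp add: v_def c_def g_def pow_fps_def power_divide)
    qed
    moreover have "a ^ n * y n = pow_coeff_asymp a t n / p n"
      by (simp add: y_def pow_coeff_asymp_def)
    moreover have "a ^ n * (eval_fps h (1 / a) * y n) = eval_fps h (1 / a) * (a ^ n * y n)"
      by (rule mult.left_commute)
    ultimately show ?thesis
      by (simp only: right_diff_distrib diff_divide_distrib times_divide_eq_right)
  qed
  thus "(\<lambda>n. (fps_nth (h * pow_fps a t) n - eval_fps h (1 / a) * pow_coeff_asymp a t n) /
          of_real (real n powr (T - 1))) \<longlonglongrightarrow> 0"
    using series by (simp add: p_def s_def)
qed

section \<open>Separating the singularities\<close>

text \<open>
  This is the value at \<open>1 / w m\<close> of the product with the factor of index \<open>m\<close> removed, that is,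
  \<open>A_coeff\<close> for an arbitrary index set.
\<close>

definition cofactor :: "'a set \<Rightarrow> ('a \<Rightarrow> complex) \<Rightarrow> ('a \<Rightarrow> complex) \<Rightarrow> 'a \<Rightarrow> complex" where
  "cofactor J w t m = (\<Prod>j\<in>J - {m}. (1 - w j / w m) powr (- t j))"

lemma cofactor_lower_other:
  fixes J :: "'a set"
  assumes "finite J" "a \<in> J" "m \<noteq> a" "w a \<noteq> w m" "w m \<noteq> 0"
  shows "cofactor J w (t(a := t a - 1)) m = (1 - w a / w m) * cofactor J w t m"
proof -
  have rem: "prod f (J - {m}) = f a * prod f (J - {m} - {a})" for f :: "'a \<Rightarrow> complex"
    by (rule prod.remove) (use assms in auto)
  have "(1 - w a / w m) powr (- (t a - 1)) = (1 - w a / w m) * (1 - w a / w m) powr (- t a)"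
    using assms powr_add[of "1 - w a / w m" "1" "- t a"] by (simp add: powr_to_1)
  moreover have "(\<Prod>j\<in>J - {m} - {a}. (1 - w j / w m) powr (- (t(a := t a - 1)) j)) =
                 (\<Prod>j\<in>J - {m} - {a}. (1 - w j / w m) powr (- t j))"
    by (intro prod.cong) auto
  ultimately show ?thesis
    unfolding cofactor_def rem by (simp add: mult.assoc)
qed

lemma prod_pow_fps_lower:
  fixes J :: "'a set"
  assumes "finite J" "a \<in> J"
  shows "(\<Prod>j\<in>J. pow_fps (w j) ((t(a := t a - 1)) j)) =
           (1 - fps_const (w a) * fps_X) * (\<Prod>j\<in>J. pow_fps (w j) (t j))"
proof -
  have rem: "prod f J = f a * prod f (J - {a})" for f :: "'a \<Rightarrow> complex fps"
    by (rule prod.remove) (use assms in auto)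
  have "(\<Prod>j\<in>J - {a}. pow_fps (w j) ((t(a := t a - 1)) j)) = (\<Prod>j\<in>J - {a}. pow_fps (w j) (t j))"
    by (intro prod.cong) auto
  thus ?thesis
    unfolding rem by (simp add: pow_fps_diff_one mult.assoc)
qed

text \<open>
  This is the product multiplied by the constant
  \<open>(w b * (1 - w a * z) - w a * (1 - w b * z)) / (w b - w a) = 1\<close>.
\<close>

lemma prod_pow_fps_split:
  assumes "finite J" "a \<in> J" "b \<in> J" "w a \<noteq> w b"
  shows "(\<Prod>j\<in>J. pow_fps (w j) (t j)) =
           fps_const (w b / (w b - w a)) * (\<Prod>j\<in>J. pow_fps (w j) ((t(a := t a - 1)) j)) +
           fps_const (- w a / (w b - w a)) * (\<Prod>j\<in>J. pow_fps (w j) ((t(b := t b - 1)) j))"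
proof -
  let ?F = "\<Prod>j\<in>J. pow_fps (w j) (t j)"
  let ?x = "fps_const (w b / (w b - w a))" and ?y = "fps_const (- w a / (w b - w a))"
  have "w b / (w b - w a) + - w a / (w b - w a) = 1"
    using assms(4) by (simp add: divide_simps)
  hence 1: "?x + ?y = 1" by (simp del: fps_const_neg)
  have "w b / (w b - w a) * w a + - w a / (w b - w a) * w b = 0"
    by (simp add: divide_simps)
  hence 2: "?x * fps_const (w a) + ?y * fps_const (w b) = 0"
    by (simp only: fps_const_mult fps_const_add fps_const_0_eq_0)
  have "?x * (1 - fps_const (w a) * fps_X) + ?y * (1 - fps_const (w b) * fps_X) =
          (?x + ?y) - (?x * fps_const (w a) + ?y * fps_const (w b)) * fps_X"
    by (simp add: algebra_simps del: fps_const_neg fps_const_mult)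
  hence "(?x * (1 - fps_const (w a) * fps_X) + ?y * (1 - fps_const (w b) * fps_X)) * ?F = ?F"
    by (simp only: 1 2) simp
  thus ?thesis
    by (simp only: prod_pow_fps_lower[OF assms(1,2)] prod_pow_fps_lower[OF assms(1,3)]
          distrib_right mult.assoc)
qed

text \<open>
  The base of the induction: all factors except one decay, and their product plays the role of \<open>h\<close>
  in \<open>mult_pow_fps_asymp\<close>.
\<close>

lemma prod_pow_fps_asymp_single:
  assumes "finite J" "a \<in> J" "norm (w a) = 1" "Re (t a) \<le> T" "B \<ge> \<bar>T - 1\<bar> + 2"
    and "\<And>j. j \<in> J - {a} \<Longrightarrow> decays B (pow_fps (w j) (t j))"
    and "\<And>j. j \<in> J - {a} \<Longrightarrow>
           eval_fps (pow_fps (w j) (t j)) (1 / w a) = (1 - w j / w a) powr (- t j)"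
  shows "(\<lambda>n. fps_nth (\<Prod>j\<in>J. pow_fps (w j) (t j)) n -
              cofactor J w t a * pow_coeff_asymp (w a) (t a) n)
           \<in> o(\<lambda>n. of_real (real n powr (T - 1)))"
proof -
  let ?h = "\<Prod>j\<in>J - {a}. pow_fps (w j) (t j)"
  have B1: "B > 1" using assms(5) by linarith
  have "decays B ?h" by (rule decays_prod) (use assms(6) B1 in auto)
  moreover have "eval_fps ?h (1 / w a) = cofactor J w t a"
    unfolding cofactor_def
    by (subst eval_fps_prod_decays[of _ B]) (use assms B1 in \<open>auto simp: norm_divide\<close>)
  moreover have "(\<Prod>j\<in>J. pow_fps (w j) (t j)) = ?h * pow_fps (w a) (t a)"
    using prod.remove[OF assms(1,2), of "\<lambda>j. pow_fps (w j) (t j)"] by (simp add: mult.commute)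
  ultimately show ?thesis
    using mult_pow_fps_asymp[of B ?h T "w a" "t a"] assms by simp
qed

text \<open>
  Induction on the total amount by which the \<open>Re (t j)\<close> with \<open>j \<in> S\<close> exceed \<open>1 - B\<close>, where \<open>B\<close>
  is the decay rate required by \<open>mult_pow_fps_asymp\<close> for the given \<open>T\<close>. While two indices \<open>a\<close> and \<open>b\<close> exceed it,
  \<open>prod_pow_fps_split\<close> lowers one of them in each of its two summands, and both summands satisfy the
  hypotheses with the same \<open>T\<close>. Otherwise at most one factor fails to decay at rate \<open>B\<close>, and
  \<open>prod_pow_fps_asymp_single\<close> applies; the main terms of the decaying factors are absorbed in the error.

  Indices outside \<open>S\<close> never need to be lowered, as their factors decay at every rate. The bound \<open>T\<close>
  does not restrict them: a polynomial factor may have an exponent \<open>t j\<close> with \<open>Re (t j) > T\<close>.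
\<close>

lemma prod_pow_fps_asymp:
  assumes J: "finite J" "S \<subseteq> J" "inj_on w J"
    and circle: "\<And>j. j \<in> S \<Longrightarrow> norm (w j) = 1"
    and T: "\<And>j. j \<in> S \<Longrightarrow> Re (t j) \<le> T"
    and tame: "\<And>j. j \<in> J - S \<Longrightarrow> norm (w j) < 1 \<or> (\<exists>k. t j = - of_nat k)"
  shows "(\<lambda>n. fps_nth (\<Prod>j\<in>J. pow_fps (w j) (t j)) n -
              (\<Sum>m\<in>S. cofactor J w t m * pow_coeff_asymp (w m) (t m) n))
           \<in> o(\<lambda>n. of_real (real n powr (T - 1)))"
proof -
  define B where "B = \<bar>T - 1\<bar> + 2"
  have B: "B > 1" "- B < T - 1" "1 - B < T" by (auto simp: B_def abs_if)
  have finS: "finite S" using J finite_subset by blast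
  define \<mu> where "\<mu> = (\<lambda>x :: complex. nat \<lceil>Re x + B - 1\<rceil>)"
  show ?thesis using T tame
  proof (induction "\<Sum>j\<in>S. \<mu> (t j)" arbitrary: t rule: less_induct)
    case less
    show ?case
    proof (cases "\<exists>a\<in>S. \<exists>b\<in>S. a \<noteq> b \<and> Re (t a) > 1 - B \<and> Re (t b) > 1 - B")
      case True
      then obtain a b where ab: "a \<in> S" "b \<in> S" "a \<noteq> b" "Re (t a) > 1 - B" "Re (t b) > 1 - B"
        by blast
      let ?D = "\<lambda>t n. fps_nth (\<Prod>j\<in>J. pow_fps (w j) (t j)) n -
                  (\<Sum>m\<in>S. cofactor J w t m * pow_coeff_asymp (w m) (t m) n)"
      let ?o = "o(\<lambda>n. complex_of_real (real n powr (T - 1)))"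
      have IH: "?D (t(c := t c - 1)) \<in> ?o" if c: "c \<in> S" "Re (t c) > 1 - B" for c
      proof (rule less.hyps)
        show "(\<Sum>j\<in>S. \<mu> ((t(c := t c - 1)) j)) < (\<Sum>j\<in>S. \<mu> (t j))"
        proof (rule sum_strict_mono_ex1[OF finS])
          have "\<mu> (t c - 1) < \<mu> (t c)" using c(2) unfolding \<mu>_def by (simp; linarith)
          thus "\<exists>j\<in>S. \<mu> ((t(c := t c - 1)) j) < \<mu> (t j)"
               "\<forall>j\<in>S. \<mu> ((t(c := t c - 1)) j) \<le> \<mu> (t j)"
            using c(1) by auto
        qed
        show "Re ((t(c := t c - 1)) j) \<le> T" if "j \<in> S" for j
          using less.prems(1)[OF that] by auto
        show "norm (w j) < 1 \<or> (\<exists>k. (t(c := t c - 1)) j = - of_nat k)" if "j \<in> J - S" for j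
          using less.prems(2)[OF that] that c(1) by auto
      qed
      have wab: "w a \<noteq> w b" using ab J by (auto dest: inj_onD)
      define x where "x = w b / (w b - w a)"
      define y where "y = - w a / (w b - w a)"
      have nz: "x \<noteq> 0" "y \<noteq> 0"
        using circle[OF ab(1)] circle[OF ab(2)] wab by (auto simp: x_def y_def)
      have inJ: "a \<in> J" "b \<in> J" using ab J by auto
      have F: "fps_nth (\<Prod>j\<in>J. pow_fps (w j) (t j)) n =
                 x * fps_nth (\<Prod>j\<in>J. pow_fps (w j) ((t(a := t a - 1)) j)) n +
                 y * fps_nth (\<Prod>j\<in>J. pow_fps (w j) ((t(b := t b - 1)) j)) n" for n
        by (subst prod_pow_fps_split[OF J(1) inJ wab]) (simp only: x_def y_def fps_add_nth fps_mult_left_const_nth)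
      let ?L = "\<lambda>t m n. cofactor J w t m * pow_coeff_asymp (w m) (t m) n"
      \<comment> \<open>The main terms combine correctly up to the error. For \<open>m\<close> other than \<open>a\<close> and \<open>b\<close> this is the
        identity above, evaluated at \<open>1 / w m\<close>. For \<open>m = a\<close> the summand in which \<open>t a\<close> is lowered is of
        smaller order, and in the other one \<open>y\<close> cancels the additional factor \<open>1 - w b / w a\<close>; likewise
        for \<open>m = b\<close>.\<close>
      have leading: "(\<lambda>n. x * ?L (t(a := t a - 1)) m n + y * ?L (t(b := t b - 1)) m n - ?L t m n) \<in> ?o"
        if m: "m \<in> S" for m
      proof -
        have m0: "w m \<noteq> 0" using circle[OF m] by auto
        have mJ: "m \<in> J" using m J by auto
        have low: "(\<lambda>n. c * pow_coeff_asymp (w m) (t m - 1) n) \<in> ?o" for c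
          using pow_coeff_asymp_smallo[of "w m" "t m - 1" T] circle[OF m] less.prems(1)[OF m]
          by (cases "c = 0") auto
        have ne: "w c \<noteq> w m" if "c \<in> J" "c \<noteq> m" for c
          using inj_onD[OF J(3), of c m] that mJ by auto
        consider "m = a" | "m = b" | "m \<noteq> a" "m \<noteq> b" by blast
        thus ?thesis
        proof cases
          case 1
          have "cofactor J w (t(b := t b - 1)) a = (1 - w b / w a) * cofactor J w t a"
            by (rule cofactor_lower_other) (use J(1) inJ ab(3) wab m0 1 in auto)
          moreover have "y * (1 - w b / w a) = 1"
            using wab m0 1 by (simp add: y_def field_simps)
          ultimately have eq: "y * cofactor J w (t(b := t b - 1)) a = cofactor J w t a"
            by (simp only: mult.assoc[symmetric]) simp
          have "y * ?L (t(b := t b - 1)) a n = ?L t a n" for n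
            using ab(3) by (simp only: fun_upd_apply if_False mult.assoc[symmetric] eq)
          hence "(\<lambda>n. x * ?L (t(a := t a - 1)) m n + y * ?L (t(b := t b - 1)) m n - ?L t m n) =
                 (\<lambda>n. x * cofactor J w (t(a := t a - 1)) a * pow_coeff_asymp (w m) (t m - 1) n)"
            unfolding 1 by (simp only: fun_upd_same add_diff_cancel_right' mult.assoc)
          thus ?thesis by (simp only: low)
        next
          case 2
          have "cofactor J w (t(a := t a - 1)) b = (1 - w a / w b) * cofactor J w t b"
            by (rule cofactor_lower_other) (use J(1) inJ ab(3) wab m0 2 in auto)
          moreover have "x * (1 - w a / w b) = 1"
            using wab m0 2 by (simp add: x_def field_simps)
          ultimately have eq: "x * cofactor J w (t(a := t a - 1)) b = cofactor J w t b"
            by (simp only: mult.assoc[symmetric]) simp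
          have "x * ?L (t(a := t a - 1)) b n = ?L t b n" for n
            using ab(3)[symmetric] by (simp only: fun_upd_apply if_False mult.assoc[symmetric] eq)
          hence "(\<lambda>n. x * ?L (t(a := t a - 1)) m n + y * ?L (t(b := t b - 1)) m n - ?L t m n) =
                 (\<lambda>n. y * cofactor J w (t(b := t b - 1)) b * pow_coeff_asymp (w m) (t m - 1) n)"
            unfolding 2 by (simp only: fun_upd_same add_diff_cancel_left' mult.assoc)
          thus ?thesis by (simp only: low)
        next
          case 3
          have "x * (1 - w a / w m) + y * (1 - w b / w m) = 1"
            using wab m0 by (simp add: x_def y_def divide_simps) (simp add: algebra_simps)
          moreover have "cofactor J w (t(a := t a - 1)) m = (1 - w a / w m) * cofactor J w t m"
            by (rule cofactor_lower_other[OF J(1) inJ(1) 3(1) ne[OF inJ(1)] m0]) (use 3 in auto)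
          moreover have "cofactor J w (t(b := t b - 1)) m = (1 - w b / w m) * cofactor J w t m"
            by (rule cofactor_lower_other[OF J(1) inJ(2) 3(2) ne[OF inJ(2)] m0]) (use 3 in auto)
          ultimately have "x * cofactor J w (t(a := t a - 1)) m + y * cofactor J w (t(b := t b - 1)) m
              = cofactor J w t m"
            by (simp only: mult.assoc[symmetric] distrib_right[symmetric]) simp
          hence "x * ?L (t(a := t a - 1)) m n + y * ?L (t(b := t b - 1)) m n = ?L t m n" for n
            using 3 by (simp only: fun_upd_apply if_False mult.assoc[symmetric] distrib_right[symmetric])
          thus ?thesis by simp
        qed
      qed
      have "(\<lambda>n. (x * ?D (t(a := t a - 1)) n + y * ?D (t(b := t b - 1)) n) +
          (\<Sum>m\<in>S. x * ?L (t(a := t a - 1)) m n + y * ?L (t(b := t b - 1)) m n - ?L t m n)) \<in> ?o"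
        using IH[OF ab(1,4)] IH[OF ab(2,5)] leading
        by (intro sum_in_smallo(1) big_sum_in_smallo landau_o.small.cmult_in_iff[THEN iffD2])
           (use nz in simp_all)
      also have "(\<lambda>n. (x * ?D (t(a := t a - 1)) n + y * ?D (t(b := t b - 1)) n) +
          (\<Sum>m\<in>S. x * ?L (t(a := t a - 1)) m n + y * ?L (t(b := t b - 1)) m n - ?L t m n)) = ?D t"
        unfolding F sum.distrib sum_subtractf sum_distrib_left[symmetric]
        by (simp add: algebra_simps)
      finally show ?thesis .
    next
      case False
      show ?thesis
      proof (cases "S = {}")
        case True
        have "decays B (\<Prod>j\<in>J. pow_fps (w j) (t j))"
        proof (rule decays_prod)
          show "decays B (pow_fps (w j) (t j))" if "j \<in> J" for j
            using less.prems(2)[of j] that True decays_pow_fps_inside decays_pow_fps_polynomial by auto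
        qed (fact B)
        thus ?thesis using decays_smallo B True by simp
      next
        case nonempty: False
        \<comment> \<open>If no exponent exceeds \<open>1 - B\<close>, any index in \<open>S\<close> can play the role of the singular one.\<close>
        obtain a where a: "a \<in> S" "\<And>j. j \<in> S - {a} \<Longrightarrow> Re (t j) \<le> 1 - B"
        proof (cases "\<exists>a\<in>S. Re (t a) > 1 - B")
          case True
          then obtain a where "a \<in> S" "Re (t a) > 1 - B" by blast
          thus ?thesis using False by (intro that[of a]) force+
        next
          case False
          thus ?thesis using nonempty that by force
        qed
        have aJ: "a \<in> J" and na: "norm (w a) = 1" using a J circle by auto
        have ne: "w j * (1 / w a) \<noteq> 1" if "j \<in> J - {a}" for j
        proof -
          have "w j \<noteq> w a" using inj_onD[OF J(3), of j a] that aJ by auto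
          thus ?thesis using na by (auto simp: divide_simps)
        qed
        have single: "decays B (pow_fps (w j) (t j)) \<and>
            eval_fps (pow_fps (w j) (t j)) (1 / w a) = (1 - w j / w a) powr (- t j)"
          if j: "j \<in> J - {a}" for j
        proof -
          have disc: ?thesis if "decays B (pow_fps (w j) (t j))" "norm (w j) \<le> 1"
            using eval_pow_fps_closed_disc[OF that(1) B(1) _ that(2) ne[OF j]] that na
            by (simp add: norm_divide)
          consider "j \<in> S" | "norm (w j) < 1" | k where "t j = - of_nat k"
            using less.prems(2)[of j] j by auto
          thus ?thesis
          proof cases
            case 1
            have "norm (w j) \<le> 1" using circle[OF 1] by simp
            thus ?thesis using disc decays_pow_fps_closed_disc[of "w j" "t j" B] a(2)[of j] 1 j by auto
          next
            case 2
            thus ?thesis using disc decays_pow_fps_inside by auto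
          next
            case 3
            thus ?thesis
              using eval_pow_fps_polynomial[of "w j" "1 / w a" k] decays_pow_fps_polynomial ne[OF j]
              by auto
          qed
        qed
        let ?L = "\<lambda>m n. cofactor J w t m * pow_coeff_asymp (w m) (t m) n"
        have "(\<lambda>n. (fps_nth (\<Prod>j\<in>J. pow_fps (w j) (t j)) n - ?L a n) - (\<Sum>m\<in>S - {a}. ?L m n))
                \<in> o(\<lambda>n. of_real (real n powr (T - 1)))"
        proof (rule sum_in_smallo(2)[OF _ big_sum_in_smallo])
          show "(\<lambda>n. fps_nth (\<Prod>j\<in>J. pow_fps (w j) (t j)) n - ?L a n)
                  \<in> o(\<lambda>n. of_real (real n powr (T - 1)))"
            by (rule prod_pow_fps_asymp_single[where B = B])
               (use J(1) aJ na less.prems(1)[OF a(1)] single in \<open>auto simp: B_def\<close>)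
          show "?L m \<in> o(\<lambda>n. of_real (real n powr (T - 1)))" if "m \<in> S - {a}" for m
            using pow_coeff_asymp_smallo[of "w m" "t m" T] circle[of m] a(2)[OF that] that B(3)
            by (cases "cofactor J w t m = 0") auto
        qed
        thus ?thesis
          by (simp only: diff_diff_eq sum.remove[OF finS a(1)])
      qed
    qed
  qed
qed

section \<open>Transfer to the generating function\<close>

theorem corollary2:
  fixes N :: nat and w \<tau> :: "nat \<Rightarrow> complex" and M :: "nat set" and W T :: real
  assumes "N \<ge> 1"
    and "\<And>j. j \<in> {0..N} \<Longrightarrow> w j \<noteq> 0"
    and "inj_on w {0..N}"
    and "M = {m \<in> {0..N}. - \<tau> m \<notin> of_nat ` {1..}}"
    and "M \<noteq> {}"
    and "W = Max ((\<lambda>m. norm (w m)) ` M)"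
    and "T = Max ((\<lambda>m. Re (\<tau> m)) ` {m \<in> M. norm (w m) = W})"
  shows "(\<lambda>n. G_coeff N \<tau> w n -
             (\<Sum>m \<in> {m \<in> M. norm (w m) = W \<and> Re (\<tau> m) = T}.
                A_coeff N \<tau> w m * w m ^ n / of_nat n powr (1 - \<tau> m) * rGamma (\<tau> m)))
         \<in> o[sequentially](\<lambda>n. of_real (W ^ n * real n powr (T - 1)))"
proof -
  let ?J = "{0..N}"
  let ?o = "o(\<lambda>n. complex_of_real (real n powr (T - 1)))"
  define S where "S = {m \<in> M. norm (w m) = W}"
  define P where "P = {m \<in> M. norm (w m) = W \<and> Re (\<tau> m) = T}"
  define u where "u = (\<lambda>j. w j / of_real W)"
  have finM: "finite M" using assms(4) by simp
  have SM: "S \<subseteq> M" "finite S" and PS: "P \<subseteq> S" "P = {m \<in> S. Re (\<tau> m) = T}"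
    using finM by (auto simp: S_def P_def)
  have "W \<in> (\<lambda>m. norm (w m)) ` M"
    unfolding assms(6) using finM assms(5) by (intro Max_in) auto
  hence W0: "W > 0" using assms(2,4) by auto
  have W_max: "norm (w m) \<le> W" if "m \<in> M" for m
    unfolding assms(6) using finM that by (intro Max_ge) auto
  have T_max: "Re (\<tau> m) \<le> T" if "m \<in> S" for m
    unfolding assms(7) using SM that by (intro Max_ge) (auto simp: S_def)
  have wu: "w j = of_real W * u j" for j using W0 by (simp add: u_def)
  have quot: "u j / u m = w j / w m" for j m using W0 by (simp add: u_def)

  have "(\<lambda>n. fps_nth (\<Prod>j\<in>?J. pow_fps (u j) (\<tau> j)) n -
              (\<Sum>m\<in>S. cofactor ?J u \<tau> m * pow_coeff_asymp (u m) (\<tau> m) n)) \<in> ?o"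
  proof (rule prod_pow_fps_asymp)
    show "S \<subseteq> ?J" using SM assms(4) by auto
    show "inj_on u ?J" using assms(3) W0 by (auto simp: inj_on_def u_def)
    show "norm (u j) = 1" if "j \<in> S" for j using that W0 by (simp add: S_def u_def norm_divide)
    show "Re (\<tau> j) \<le> T" if "j \<in> S" for j using that by (rule T_max)
    show "norm (u j) < 1 \<or> (\<exists>k. \<tau> j = - of_nat k)" if j: "j \<in> ?J - S" for j
    proof (cases "j \<in> M")
      case True
      hence "norm (w j) < W" using W_max[OF True] j by (auto simp: S_def)
      thus ?thesis using W0 by (simp add: u_def norm_divide)
    next
      case False
      then obtain k where "- \<tau> j = of_nat k" using j assms(4) by auto
      hence "\<tau> j = - of_nat k" by (metis minus_minus)
      thus ?thesis by blast
    qed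
  qed simp
  \<comment> \<open>Singularities on the circle with \<open>Re (\<tau> m) < T\<close> contribute only to the error.\<close>
  moreover have "(\<lambda>n. \<Sum>m\<in>S - P. cofactor ?J u \<tau> m * pow_coeff_asymp (u m) (\<tau> m) n) \<in> ?o"
  proof (rule big_sum_in_smallo)
    fix m assume m: "m \<in> S - P"
    hence "Re (\<tau> m) < T" using T_max[of m] PS(2) by force
    moreover have "norm (u m) = 1" using m W0 by (simp add: S_def u_def norm_divide)
    ultimately show "(\<lambda>n. cofactor ?J u \<tau> m * pow_coeff_asymp (u m) (\<tau> m) n) \<in> ?o"
      using pow_coeff_asymp_smallo[of "u m" "\<tau> m" T]
      by (cases "cofactor ?J u \<tau> m = 0") auto
  qed
  ultimately have "(\<lambda>n. (fps_nth (\<Prod>j\<in>?J. pow_fps (u j) (\<tau> j)) n -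
              (\<Sum>m\<in>S. cofactor ?J u \<tau> m * pow_coeff_asymp (u m) (\<tau> m) n)) +
              (\<Sum>m\<in>S - P. cofactor ?J u \<tau> m * pow_coeff_asymp (u m) (\<tau> m) n)) \<in> ?o"
    by (rule sum_in_smallo(1))
  hence main: "(\<lambda>n. fps_nth (\<Prod>j\<in>?J. pow_fps (u j) (\<tau> j)) n -
              (\<Sum>m\<in>P. cofactor ?J u \<tau> m * pow_coeff_asymp (u m) (\<tau> m) n)) \<in> ?o"
    unfolding sum.subset_diff[OF PS(1) SM(2)] by simp

  have "gen_fun N \<tau> w has_fps_expansion (\<Prod>j\<in>?J. pow_fps (w j) (\<tau> j))"
    unfolding gen_fun_def by (intro has_fps_expansion_prod pow_fps_has_fps_expansion)
  hence "fps_expansion (gen_fun N \<tau> w) 0 = (\<Prod>j\<in>?J. pow_fps (w j) (\<tau> j))"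
    by (rule fps_expansion_eqI)
  hence G: "G_coeff N \<tau> w n = of_real W ^ n * fps_nth (\<Prod>j\<in>?J. pow_fps (u j) (\<tau> j)) n" for n
    using prod_pow_fps_scale[of ?J "of_real W" u \<tau> n] by (simp add: G_coeff_def wu)
  have A: "A_coeff N \<tau> w m = cofactor ?J u \<tau> m" for m
    by (simp add: A_coeff_def cofactor_def quot)
  have A': "A_coeff N \<tau> w m * w m ^ n / of_nat n powr (1 - \<tau> m) * rGamma (\<tau> m) =
      of_real W ^ n * (cofactor ?J u \<tau> m * pow_coeff_asymp (u m) (\<tau> m) n)" for m n
  proof -
    have "of_nat n powr (\<tau> m - 1) = inverse (of_nat n powr (1 - \<tau> m) :: complex)"
      by (simp flip: powr_minus)
    thus ?thesis
      by (simp add: A pow_coeff_asymp_def wu[of m] power_mult_distrib divide_inverse mult_ac)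
  qed
  have "(\<lambda>n. of_real W ^ n * (fps_nth (\<Prod>j\<in>?J. pow_fps (u j) (\<tau> j)) n -
              (\<Sum>m\<in>P. cofactor ?J u \<tau> m * pow_coeff_asymp (u m) (\<tau> m) n)))
          \<in> o(\<lambda>n. of_real W ^ n * complex_of_real (real n powr (T - 1)))"
    by (rule landau_o.small.mult_left[OF main])
  thus ?thesis
    unfolding G A' P_def[symmetric] sum_distrib_left[symmetric] right_diff_distrib[symmetric]
    by simp
qed
end
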